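(* The random variables $V^{(1)}$ and $V^{(2)}$ are dependent (i.e. not independent).
   Context: Parameters: $\alpha\in(1,2)$, $\mu_A\in(0,1)$, $\sigma_A^2\in(0,\infty)$, $\theta:=1-\mu_A^\alpha$. $(V^{(1)},V^{(2)})$ is a random vector with $$(V^{(1)},V^{(2)})\stackrel{d}{=}\biggl(\frac{1}{1-\mu_A^2}\sum_{i=1}^\infty P_i^2,\ \frac{1}{(1-\mu_A^3)^{1/2}}\sum_{i=1}^\infty P_i^{3/2}Z_i\biggr),$$ where $\sum_{i=1}^\infty\delta_{P_i}$ is a Poisson point process on $(0,\infty)$ with intensity $\theta\alpha y^{-\alpha-1}\,\mathrm{d}y$, with $P_1\ge P_2\ge\cdots$ almost surely, and $(Z_i)_{i\ge1}$ is an i.i.d. sequence of $\mathcal{N}(0,\sigma_A^2)$-distributed random variables independent of it; both series converge almost surely. Equivalently, its joint characteristic function is $$\mathbb{E}\bigl[\mathrm{e}^{\mathrm{i}(sV^{(1)}+tV^{(2)})}\bigr]=\exp\biggl\{\theta\int_0^\infty\biggl(\exp\biggl\{\frac{\mathrm{i}s}{1-\mu_A^2}y^2-\frac{\sigma_A^2t^2}{2(1-\mu_A^3)}y^3\biggr\}-1\biggr)\alpha y^{-\alpha-1}\,\mathrm{d}y\biggr\},\quad s,t\in\mathbb{R}.$$ *)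

theory Defs
  imports "HOL-Probability.Probability"
begin

text \<open>The point measure \<open>\<Sum>i. \<delta>\<^bsub>x i\<^esub>\<close> on the measurable space \<open>E\<close>: the image of counting
  measure on the index set, so that coinciding points are counted with multiplicity.\<close>

definition sum_dirac :: "'a measure \<Rightarrow> (nat \<Rightarrow> 'a) \<Rightarrow> 'a measure" where
  "sum_dirac E x = distr (count_space UNIV) E x"

lemma emeasure_sum_dirac:
  assumes "\<And>i. x i \<in> space E" and B: "B \<in> sets E"
  shows "emeasure (sum_dirac E x) B = (\<Sum>i. emeasure (return E (x i)) B)"
proof -
  have "emeasure (sum_dirac E x) B = (\<integral>\<^sup>+ y. indicator B y \<partial>sum_dirac E x)"
    using B by (simp add: sum_dirac_def)
  also have "\<dots> = (\<integral>\<^sup>+ i. indicator B (x i) \<partial>count_space UNIV)"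
    unfolding sum_dirac_def using assms by (intro nn_integral_distr) auto
  also have "\<dots> = (\<Sum>i. indicator B (x i))"
    by (rule nn_integral_count_space_nat)
  finally show ?thesis using B by simp
qed

text \<open>\<open>\<xi>\<close> is a Poisson point process with intensity measure \<open>\<Lambda>\<close> on the measurable space underlying
  \<open>\<Lambda>\<close>. As usual, the Poisson distribution with infinite mean is the point mass at \<open>\<infinity>\<close>.
  The Poisson weights are written out because \<open>poisson_pmf\<close> is unspecified at rate \<open>0\<close>, which
  occurs here for null sets \<open>B\<close>; with \<open>0 ^ 0 = 1\<close> the weights give the point mass at \<open>0\<close>.
  Measurability of the counts \<open>\<xi>(B)\<close> is part of \<open>prob_space.indep_vars\<close> (take \<open>n = 1\<close>).\<close>

definition poisson_point_process ::
    "'w measure \<Rightarrow> ('w \<Rightarrow> 'a measure) \<Rightarrow> 'a measure \<Rightarrow> bool" where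
  "poisson_point_process M \<xi> \<Lambda> \<longleftrightarrow>
     prob_space M \<and>
     (\<forall>\<omega>\<in>space M. sets (\<xi> \<omega>) = sets \<Lambda>) \<and>
     (\<forall>B\<in>sets \<Lambda>. emeasure \<Lambda> B < \<infinity> \<longrightarrow>
        (\<forall>k::nat. measure M {\<omega> \<in> space M. emeasure (\<xi> \<omega>) B = of_nat k}
                  = measure \<Lambda> B ^ k / fact k * exp (- measure \<Lambda> B))) \<and>
     (\<forall>B\<in>sets \<Lambda>. emeasure \<Lambda> B = \<infinity> \<longrightarrow> (AE \<omega> in M. emeasure (\<xi> \<omega>) B = \<infinity>)) \<and>
     (\<forall>n::nat. \<forall>B. B ` {..<n} \<subseteq> sets \<Lambda> \<longrightarrow> disjoint_family_on B {..<n} \<longrightarrow>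
        prob_space.indep_vars M (\<lambda>_. borel) (\<lambda>i \<omega>. emeasure (\<xi> \<omega>) (B i)) {..<n})"

definition power_intensity :: "real \<Rightarrow> real \<Rightarrow> real measure" where
  "power_intensity \<theta> \<alpha> =
     density (restrict_space lborel {0<..}) (\<lambda>y. ennreal (\<theta> * \<alpha> * y powr (- \<alpha> - 1)))"

end

theory Submission imports Defs begin

text \<open>Write \<open>A = \<Sum>i. (P i)\<^sup>2\<close> and \<open>S = \<Sum>i. P i powr (3/2) * Z i\<close>; up to nonzero constant
factors, \<open>(V1, V2)\<close> has the same law as \<open>(A, S)\<close>. Given the points, \<open>S\<close> is a centred normal variable with variance proportional to
\<open>B = \<Sum>i. (P i) ^ 3\<close>. A bound on \<open>A\<close> forces a bound on \<open>B\<close>, namely \<open>B \<le> A powr (3/2)\<close>, so on an event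
\<open>{A \<le> K}\<close> the second moment of \<open>S\<close> is finite (\<open>second_moment_given_small_points\<close>). Without that
restriction it is infinite (\<open>second_moment_infinite\<close>), because \<open>B \<ge> (P 0) ^ 3\<close> and the largest point
has such a heavy tail that its third moment diverges (\<open>largest_point_third_moment_infinite\<close>; the tail
index \<open>\<alpha>\<close> is below \<open>3\<close>). If \<open>A\<close> and \<open>S\<close> were independent, the second moment of \<open>S\<close> would be the same
given \<open>{A \<le> K}\<close> as without conditioning, for any \<open>K\<close> that makes the event non-null.

Both moment estimates need the series to converge almost surely. For \<open>A\<close> this follows from Campbell's
formula (\<open>campbell_formula\<close>). The series \<open>S\<close> need not converge absolutely. Its coefficients decrease and
are at most of order \<open>i powr (- 3/4)\<close>, because \<open>P i\<close> is decreasing and square summable, while almost surely the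
partial sums of the weights \<open>Z\<close> grow at most like \<open>n powr (5/8)\<close> (\<open>AE_normal_random_walk_growth\<close>). Summation
by parts then gives convergence for each such outcome (\<open>summable_mult_of_partial_sums_growth\<close>).\<close>

section \<open>Points of the Poisson process\<close>

lemma AE_summable_if_nn_integral_finite:
  fixes X :: "nat \<Rightarrow> 'a \<Rightarrow> real"
  assumes [measurable]: "\<And>i. X i \<in> borel_measurable M"
    and nonneg: "\<And>i \<omega>. \<omega> \<in> space M \<Longrightarrow> 0 \<le> X i \<omega>"
    and fin: "(\<integral>\<^sup>+\<omega>. (\<Sum>i. ennreal (X i \<omega>)) \<partial>M) \<noteq> \<infinity>"
  shows "AE \<omega> in M. summable (\<lambda>i. X i \<omega>)"
proof -
  have "AE \<omega> in M. (\<Sum>i. ennreal (X i \<omega>)) \<noteq> \<infinity>"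
    using fin by (intro nn_integral_noteq_infinite) auto
  then show ?thesis
    by (rule AE_mp) (intro AE_I2 impI summable_suminf_not_top, auto intro: nonneg)
qed

lemma sums_poisson_weights: "(\<lambda>k. l ^ k / fact k * exp (- l)) sums (1::real)"
proof -
  have "(\<lambda>k. l ^ k /\<^sub>R fact k * exp (- l)) sums (exp l * exp (- l))"
    by (intro sums_mult2 exp_converges)
  then show ?thesis by (simp add: exp_minus field_simps)
qed

lemma sums_poisson_mean: "(\<lambda>k. real k * (l ^ k / fact k * exp (- l))) sums l"
proof -
  have "(\<lambda>k. l * (l ^ k / fact k * exp (- l))) sums (l * 1)"
    by (intro sums_mult sums_poisson_weights)
  moreover have "(\<lambda>k. l * (l ^ k / fact k * exp (- l)))
      = (\<lambda>k. real (Suc k) * (l ^ Suc k / fact (Suc k) * exp (- l)))"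
    by (auto simp: fun_eq_iff field_simps simp del: of_nat_Suc)
  ultimately have "(\<lambda>k. real (Suc k) * (l ^ Suc k / fact (Suc k) * exp (- l))) sums l"
    by simp
  then show ?thesis by (subst (asm) sums_Suc_iff) simp
qed

text \<open>\<open>N\<close> takes values in \<open>ennreal\<close> and only its masses at the finite integers are given. They already add
up to one, so \<open>N\<close> is almost surely finite and its mean is the usual Poisson mean.\<close>

lemma nn_integral_poisson_count:
  assumes "prob_space M" and [measurable]: "N \<in> borel_measurable M" and l: "0 \<le> l"
    and weights: "\<And>k. measure M {\<omega> \<in> space M. N \<omega> = of_nat k} = l ^ k / fact k * exp (- l)"
  shows "(\<integral>\<^sup>+\<omega>. N \<omega> \<partial>M) = ennreal l"
proof -
  interpret prob_space M by fact
  let ?A = "\<lambda>k::nat. {\<omega> \<in> space M. N \<omega> = of_nat k}"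
  have disj: "disjoint_family ?A"
    by (auto simp: disjoint_family_on_def)
  have "(\<lambda>k. measure M (?A k)) sums measure M (\<Union>k. ?A k)"
    by (rule finite_measure_UNION) (auto simp: disj)
  with sums_poisson_weights[of l] have "prob (\<Union>k. ?A k) = 1"
    unfolding weights by (rule sums_unique2[symmetric])
  then have ae: "AE \<omega> in M. \<omega> \<in> (\<Union>k. ?A k)"
    by (subst (asm) prob_eq_1) auto
  have one: "(\<Sum>k. of_nat k * indicator (?A k) \<omega>) = N \<omega>" if "\<omega> \<in> ?A n" for \<omega> n
  proof -
    have "(\<lambda>k. of_nat k * indicator (?A k) \<omega>) = (\<lambda>k. if k = n then N \<omega> else 0)"
      using that by (auto simp: fun_eq_iff indicator_def)
    then show ?thesis using sums_single[of n "\<lambda>_. N \<omega>"] by (simp add: sums_iff)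
  qed
  have mass: "of_nat k * emeasure M (?A k) = ennreal (real k * (l ^ k / fact k * exp (- l)))" for k
    unfolding emeasure_eq_measure weights
    using l by (simp add: ennreal_of_nat_eq_real_of_nat ennreal_mult[symmetric])
  have "(\<integral>\<^sup>+\<omega>. N \<omega> \<partial>M) = (\<integral>\<^sup>+\<omega>. (\<Sum>k. of_nat k * indicator (?A k) \<omega>) \<partial>M)"
    using ae by (intro nn_integral_cong_AE) (auto simp del: suminf_mult simp: one)
  also have "\<dots> = (\<Sum>k. of_nat k * emeasure M (?A k))"
    by (subst nn_integral_suminf) (auto simp: nn_integral_cmult)
  also have "\<dots> = (\<Sum>k. ennreal (real k * (l ^ k / fact k * exp (- l))))"
    unfolding mass ..
  also have "\<dots> = ennreal l"
    using l sums_poisson_mean[of l] by (intro suminf_ennreal_eq) auto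
  finally show ?thesis .
qed

text \<open>The set function that sends \<open>B\<close> to the mean number of points in \<open>B\<close> is itself a measure, the image of
counting measure times \<open>M\<close> under \<open>(i, \<omega>) \<mapsto> P i \<omega>\<close>. It agrees with \<open>\<Lambda>\<close> on every set, so integrals
against both measures agree.\<close>

lemma campbell_formula:
  assumes ppp: "poisson_point_process M (\<lambda>\<omega>. sum_dirac E (\<lambda>i. P i \<omega>)) \<Lambda>"
    and P[measurable]: "\<And>i. P i \<in> measurable M E"
    and sets_eq: "sets E = sets \<Lambda>"
    and f[measurable]: "f \<in> borel_measurable E"
  shows "(\<integral>\<^sup>+\<omega>. (\<Sum>i. f (P i \<omega>)) \<partial>M) = (\<integral>\<^sup>+y. f y \<partial>\<Lambda>)"
proof -
  interpret prob_space M using ppp by (simp add: poisson_point_process_def)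
  let ?C = "count_space (UNIV::nat set)"
  have [measurable]: "(\<lambda>(i, \<omega>). P i \<omega>) \<in> measurable (?C \<Otimes>\<^sub>M M) E"
    by (rule measurable_pair_measure_countable1) auto
  have integral: "(\<integral>\<^sup>+y. g y \<partial>distr (?C \<Otimes>\<^sub>M M) E (\<lambda>(i, \<omega>). P i \<omega>)) = (\<integral>\<^sup>+\<omega>. (\<Sum>i. g (P i \<omega>)) \<partial>M)"
    if [measurable]: "g \<in> borel_measurable E" for g
    by (subst nn_integral_distr, measurable)
       (simp add: nn_integral_fst[symmetric] split_beta' nn_integral_count_space_nat nn_integral_suminf)
  have "distr (?C \<Otimes>\<^sub>M M) E (\<lambda>(i, \<omega>). P i \<omega>) = \<Lambda>"
  proof (rule measure_eqI)
    fix B assume "B \<in> sets (distr (?C \<Otimes>\<^sub>M M) E (\<lambda>(i, \<omega>). P i \<omega>))"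
    then have B[measurable]: "B \<in> sets E" by simp
    let ?N = "\<lambda>\<omega>. emeasure (sum_dirac E (\<lambda>i. P i \<omega>)) B"
    have N: "?N \<omega> = (\<Sum>i. indicator B (P i \<omega>))" if "\<omega> \<in> space M" for \<omega>
      using that by (subst emeasure_sum_dirac) (auto intro: measurable_space[OF P])
    have Nm: "?N \<in> borel_measurable M"
      by (subst measurable_cong[OF N]) auto
    have "emeasure (distr (?C \<Otimes>\<^sub>M M) E (\<lambda>(i, \<omega>). P i \<omega>)) B = (\<integral>\<^sup>+\<omega>. ?N \<omega> \<partial>M)"
      using integral[of "indicator B"] by (simp add: N cong: nn_integral_cong)
    also have "\<dots> = emeasure \<Lambda> B"
    proof (cases "emeasure \<Lambda> B < \<infinity>")
      case True
      with ppp B sets_eq have "(\<integral>\<^sup>+\<omega>. ?N \<omega> \<partial>M) = ennreal (measure \<Lambda> B)"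
        by (intro nn_integral_poisson_count Nm) (auto simp: poisson_point_process_def)
      also have "\<dots> = emeasure \<Lambda> B"
        using True by (simp add: emeasure_eq_ennreal_measure)
      finally show ?thesis .
    next
      case False
      then have inf: "emeasure \<Lambda> B = \<infinity>" by (simp add: less_top[symmetric])
      with ppp B sets_eq have "AE \<omega> in M. ?N \<omega> = \<infinity>"
        by (auto simp: poisson_point_process_def)
      then have "(\<integral>\<^sup>+\<omega>. ?N \<omega> \<partial>M) = (\<integral>\<^sup>+\<omega>. \<infinity> \<partial>M)" by (rule nn_integral_cong_AE)
      then show ?thesis by (simp add: inf emeasure_space_1)
    qed
    finally show "emeasure (distr (?C \<Otimes>\<^sub>M M) E (\<lambda>(i, \<omega>). P i \<omega>)) B = emeasure \<Lambda> B" .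
  qed (simp add: sets_eq)
  with integral[OF f] show ?thesis by simp
qed

lemma nn_integral_power_intensity:
  assumes [measurable]: "f \<in> borel_measurable borel"
  shows "(\<integral>\<^sup>+y. f y \<partial>power_intensity \<theta> \<alpha>)
    = (\<integral>\<^sup>+y. ennreal (\<theta> * \<alpha> * y powr (- \<alpha> - 1)) * f y * indicator {0<..} y \<partial>lborel)"
  unfolding power_intensity_def
  by (subst nn_integral_density) (auto simp: nn_integral_restrict_space measurable_restrict_space1)

lemma power_intensity_min_square_finite:
  assumes "1 < \<alpha>" "\<alpha> < 2" "0 < \<theta>"
  shows "(\<integral>\<^sup>+y. ennreal (min (y\<^sup>2) 1) \<partial>power_intensity \<theta> \<alpha>) < \<infinity>"
proof -
  \<comment> \<open>Up to the factor \<open>\<theta> * \<alpha>\<close>, the integrand is \<open>y\<^sup>2 * y powr (- \<alpha> - 1)\<close> up to \<open>1\<close>, which is integrable at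
    \<open>0\<close> because \<open>\<alpha> < 2\<close>, and \<open>y powr (- \<alpha> - 1)\<close> beyond \<open>1\<close>.\<close>
  have near: "(\<integral>\<^sup>+y. ennreal (y powr (1 - \<alpha>)) * indicator {0..1} y \<partial>lborel)
      = ennreal (1 powr (1 - \<alpha> + 1) / (1 - \<alpha> + 1))"
    using assms by (intro nn_integral_has_integral_lebesgue' has_integral_powr_from_0) auto
  have far: "(\<integral>\<^sup>+y. ennreal (y powr (- \<alpha> - 1)) * indicator {1..} y \<partial>lborel)
      = ennreal (- (1 powr (- \<alpha> - 1 + 1)) / (- \<alpha> - 1 + 1))"
    using assms by (intro nn_integral_has_integral_lebesgue' has_integral_powr_to_inf) auto
  have "(\<integral>\<^sup>+y. ennreal (min (y\<^sup>2) 1) \<partial>power_intensity \<theta> \<alpha>)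
     \<le> (\<integral>\<^sup>+y. ennreal (\<theta> * \<alpha>) * (ennreal (y powr (1 - \<alpha>)) * indicator {0..1} y)
          + ennreal (\<theta> * \<alpha>) * (ennreal (y powr (- \<alpha> - 1)) * indicator {1..} y) \<partial>lborel)"
  proof (subst nn_integral_power_intensity, measurable, intro nn_integral_mono)
    fix y :: real
    have "y\<^sup>2 * y powr (- \<alpha> - 1) = y powr (1 - \<alpha>)" if "0 < y"
      using that by (simp add: powr_numeral[symmetric] powr_add[symmetric] del: powr_numeral)
    moreover have "min (y\<^sup>2) 1 = (if y \<le> 1 then y\<^sup>2 else 1)" if "0 < y"
      using that by (simp add: min_def power_le_one_iff)
    ultimately show "ennreal (\<theta> * \<alpha> * y powr (- \<alpha> - 1)) * ennreal (min (y\<^sup>2) 1) * indicator {0<..} y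
       \<le> ennreal (\<theta> * \<alpha>) * (ennreal (y powr (1 - \<alpha>)) * indicator {0..1} y)
          + ennreal (\<theta> * \<alpha>) * (ennreal (y powr (- \<alpha> - 1)) * indicator {1..} y)"
      using assms by (auto simp: indicator_def ennreal_mult'[symmetric] ennreal_plus[symmetric] 
         mult_ac simp del: ennreal_plus)
  qed
  also have "\<dots> < \<infinity>"
    by (subst nn_integral_add) (auto simp: nn_integral_cmult near far ennreal_mult_less_top)
  finally show ?thesis .
qed

text \<open>The squares themselves may have infinite mean sum because of the large points. Truncating them at \<open>1\<close>
makes the mean finite, and the terms of a convergent series are eventually below the truncation level.\<close>

lemma AE_summable_points_squared:
  assumes params: "1 < \<alpha>" "\<alpha> < 2" "0 < \<theta>"
    and P[measurable]: "\<And>i. P i \<in> measurable M (restrict_space borel {0<..})"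
    and ppp: "poisson_point_process M
        (\<lambda>\<omega>. sum_dirac (restrict_space borel {0<..}) (\<lambda>i. P i \<omega>)) (power_intensity \<theta> \<alpha>)"
  shows "AE \<omega> in M. summable (\<lambda>i. (P i \<omega>)\<^sup>2)"
proof -
  have [measurable]: "P i \<in> borel_measurable M" for i
    using P[of i] by (simp add: measurable_restrict_space2_iff)
  have sets_eq: "sets (restrict_space borel {0<..}) = sets (power_intensity \<theta> \<alpha>)"
    by (simp add: power_intensity_def sets_restrict_space)
  have "(\<integral>\<^sup>+\<omega>. (\<Sum>i. ennreal (min ((P i \<omega>)\<^sup>2) 1)) \<partial>M)
      = (\<integral>\<^sup>+y. ennreal (min (y\<^sup>2) 1) \<partial>power_intensity \<theta> \<alpha>)"
    by (rule campbell_formula[OF ppp P sets_eq]) (simp add: measurable_restrict_space1)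
  also have "\<dots> < \<infinity>" by (intro power_intensity_min_square_finite params)
  finally have "AE \<omega> in M. summable (\<lambda>i. min ((P i \<omega>)\<^sup>2) 1)"
    by (intro AE_summable_if_nn_integral_finite) auto
  then show ?thesis
  proof (rule AE_mp, intro AE_I2 impI)
    fix \<omega> assume s: "summable (\<lambda>i. min ((P i \<omega>)\<^sup>2) 1)"
    then have "\<forall>\<^sub>F i in sequentially. min ((P i \<omega>)\<^sup>2) 1 < 1"
      by (intro order_tendstoD(2)[OF summable_LIMSEQ_zero]) auto
    then have "\<forall>\<^sub>F i in sequentially. min ((P i \<omega>)\<^sup>2) 1 = (P i \<omega>)\<^sup>2"
      by eventually_elim auto
    then show "summable (\<lambda>i. (P i \<omega>)\<^sup>2)" using s by (simp add: summable_cong)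
  qed
qed

text \<open>A crude lower bound on the mass of the tail: \<open>y powr (- \<alpha> - 1) \<ge> y powr (- 3)\<close> for \<open>y \<ge> 1\<close>, on an
interval of length \<open>x\<close>. The resulting order \<open>x powr (- 2)\<close> exceeds the order \<open>x powr (- 3)\<close> at which third moments diverge.\<close>

lemma power_intensity_dyadic_interval:
  assumes "1 < \<alpha>" "\<alpha> < 2" "0 < \<theta>" "1 \<le> x"
  shows "emeasure (power_intensity \<theta> \<alpha>) {x<..2 * x} < \<infinity>"
    and "\<theta> / (8 * x\<^sup>2) \<le> measure (power_intensity \<theta> \<alpha>) {x<..2 * x}"
proof -
  let ?f = "\<lambda>y::real. \<theta> * \<alpha> * y powr (- \<alpha> - 1)"
  have [measurable]: "{x<..2 * x} \<in> sets (restrict_space lborel {0<..})"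
    using assms by (subst sets_restrict_space_iff) auto
  have eq: "emeasure (power_intensity \<theta> \<alpha>) {x<..2 * x}
      = (\<integral>\<^sup>+y. ennreal (?f y) * indicator {x<..2 * x} y \<partial>lborel)"
    unfolding power_intensity_def using assms
    by (subst emeasure_density)
       (auto simp: nn_integral_restrict_space measurable_restrict_space1 indicator_def intro!: nn_integral_cong)
  have "(\<integral>\<^sup>+y. ennreal (?f y) * indicator {x<..2 * x} y \<partial>lborel) \<le> (\<integral>\<^sup>+y. ennreal (\<theta> * \<alpha>) * indicator {x<..2 * x} y \<partial>lborel)"
    proof (intro nn_integral_mono)
    fix y
    have "y powr (- \<alpha> - 1) \<le> y powr 0" if "x < y"
      using that assms by (intro powr_mono) auto
    then show "ennreal (?f y) * indicator {x<..2 * x} y \<le> ennreal (\<theta> * \<alpha>) * indicator {x<..2 * x} y"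
      using assms by (auto simp: indicator_def intro!: ennreal_leI mult_left_le)
  qed

  then show fin: "emeasure (power_intensity \<theta> \<alpha>) {x<..2 * x} < \<infinity>"
    unfolding eq using assms by (simp add: nn_integral_cmult ennreal_mult[symmetric] order_le_less_trans)
  have "(\<integral>\<^sup>+y. ennreal (\<theta> / (8 * x ^ 3)) * indicator {x<..2 * x} y \<partial>lborel) \<le> emeasure (power_intensity \<theta> \<alpha>) {x<..2 * x}"
    unfolding eq
      proof (intro nn_integral_mono)
    fix y
    have "1 / (8 * x ^ 3) \<le> y powr (- \<alpha> - 1)" if "x < y" "y \<le> 2 * x"
    proof -
      have "1 / (8 * x ^ 3) = inverse ((2 * x) ^ 3)"
        by (simp add: power_mult_distrib field_simps)
      also have "\<dots> \<le> inverse (y ^ 3)"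
        using that assms by (intro le_imp_inverse_le power_mono) auto
      also have "\<dots> = y powr (- 3)"
        using that assms by (simp add: powr_minus)
      also have "\<dots> \<le> y powr (- \<alpha> - 1)"
        using that assms by (intro powr_mono) auto
      finally show ?thesis .
    qed
    moreover have "1 / (8 * x ^ 3) \<le> \<alpha> * (1 / (8 * x ^ 3))"
      using assms by (intro mult_le_cancel_right1[THEN iffD2]) auto
    ultimately have "1 / (8 * x ^ 3) \<le> \<alpha> * y powr (- \<alpha> - 1)" if "x < y" "y \<le> 2 * x"
      using that assms mult_left_mono[of "1 / (8 * x ^ 3)" "y powr (- \<alpha> - 1)" \<alpha>] by linarith
    from mult_left_mono[OF this, of \<theta>]
    show "ennreal (\<theta> / (8 * x ^ 3)) * indicator {x<..2 * x} y \<le> ennreal (?f y) * indicator {x<..2 * x} y"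
      using assms by (auto simp: indicator_def mult.assoc intro!: ennreal_leI)
  qed

  also have "(\<integral>\<^sup>+y. ennreal (\<theta> / (8 * x ^ 3)) * indicator {x<..2 * x} y \<partial>lborel) = ennreal (\<theta> / (8 * x\<^sup>2))"
    using assms by (simp add: nn_integral_cmult ennreal_mult[symmetric] power2_eq_square power3_eq_cube)
  finally show "\<theta> / (8 * x\<^sup>2) \<le> measure (power_intensity \<theta> \<alpha>) {x<..2 * x}"
    using fin by (simp add: emeasure_eq_ennreal_measure)
qed

text \<open>The largest point exceeds \<open>x\<close> as soon as some point lies in \<open>{x<..2 * x}\<close>, which has probability of
order at least \<open>x powr (- 2)\<close>. Hence the third moment is at least of order \<open>x\<close>, for every \<open>x \<ge> 1\<close>.\<close>

lemma largest_point_third_moment_infinite: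
  assumes params: "1 < \<alpha>" "\<alpha> < 2" "0 < \<theta>" "\<theta> \<le> 1"
    and P[measurable]: "\<And>i. P i \<in> measurable M (restrict_space borel {0<..})"
    and ppp: "poisson_point_process M
        (\<lambda>\<omega>. sum_dirac (restrict_space borel {0<..}) (\<lambda>i. P i \<omega>)) (power_intensity \<theta> \<alpha>)"
    and dec: "AE \<omega> in M. decseq (\<lambda>i. P i \<omega>)"
  shows "(\<integral>\<^sup>+\<omega>. ennreal ((P 0 \<omega>) ^ 3) \<partial>M) = \<infinity>"
proof -
  interpret prob_space M using ppp by (simp add: poisson_point_process_def)
  have [measurable]: "P i \<in> borel_measurable M" for i
    using P[of i] by (simp add: measurable_restrict_space2_iff)
  have lower: "ennreal (\<theta> / 16 * x) \<le> (\<integral>\<^sup>+\<omega>. ennreal ((P 0 \<omega>) ^ 3) \<partial>M)" if x: "1 \<le> x" for x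
  proof -
    let ?B = "{x<..2 * x}" and ?l = "measure (power_intensity \<theta> \<alpha>) {x<..2 * x}" and ?u = "\<theta> / (8 * x\<^sup>2)"
    let ?N = "\<lambda>\<omega>. emeasure (sum_dirac (restrict_space borel {0<..}) (\<lambda>i. P i \<omega>)) ?B"
    let ?E = "{\<omega> \<in> space M. \<exists>i. P i \<omega> \<in> ?B}"
    have B: "?B \<in> sets (restrict_space borel {0<..})"
      using x by (subst sets_restrict_space_iff) auto
    have N: "?N \<omega> = (\<Sum>i. indicator ?B (P i \<omega>))" if "\<omega> \<in> space M" for \<omega>
      using that B measurable_space[OF P] by (subst emeasure_sum_dirac) (auto simp: indicator_def)
    \<comment> \<open>The event that no point falls into the interval has probability \<open>exp (- ?l)\<close>, and
      \<open>exp (- u) \<le> 1 / (1 + u) \<le> 1 - u / 2\<close> for \<open>u\<close> in the unit interval.\<close>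
    have "?N \<omega> = 0 \<longleftrightarrow> \<omega> \<notin> ?E" if "\<omega> \<in> space M" for \<omega>
      using that by (simp add: N suminf_eq_zero_iff indicator_def)
    then have "{\<omega> \<in> space M. ?N \<omega> = of_nat 0} = space M - ?E" by auto
    moreover have "prob {\<omega> \<in> space M. ?N \<omega> = of_nat 0} = ?l ^ 0 / fact 0 * exp (- ?l)"
    proof -
      have "?B \<in> sets (power_intensity \<theta> \<alpha>)"
        using B by (simp add: power_intensity_def sets_restrict_space)
      with ppp power_intensity_dyadic_interval(1)[OF params(1-3) x] show ?thesis
        unfolding poisson_point_process_def by blast
    qed
    ultimately have "prob (space M - ?E) = exp (- ?l)" by simp
    moreover have "prob (space M - ?E) = 1 - prob ?E" by (rule prob_compl) measurable
    ultimately have "prob ?E = 1 - exp (- ?l)" by linarith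
    moreover have "exp (- ?l) \<le> exp (- ?u)"
      using power_intensity_dyadic_interval(2)[OF params(1-3) x] by simp
    moreover have u: "0 \<le> ?u" "?u \<le> 1"
      using params x mult_mono[of 1 x 1 x] by (auto simp: power2_eq_square divide_simps)
    have "exp (- ?u) \<le> 1 / (1 + ?u)"
      using exp_ge_add_one_self[of ?u] u by (simp add: exp_minus field_simps)
    moreover have "1 / (1 + ?u) \<le> 1 - ?u / 2"
    proof -
      have "1 \<le> (1 - ?u / 2) * (1 + ?u)"
        using u mult_left_mono[OF u(2) u(1)] by (simp add: algebra_simps)
      then show ?thesis using u by (simp add: pos_divide_le_eq)
    qed
    ultimately have prob: "?u / 2 \<le> prob ?E" by linarith
    have "ennreal (\<theta> / 16 * x) = ennreal (x ^ 3) * ennreal (?u / 2)"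
      using params x by (simp add: ennreal_mult'[symmetric] power2_eq_square power3_eq_cube)
    also have "\<dots> \<le> ennreal (x ^ 3) * emeasure M ?E"
      using prob by (intro mult_left_mono) (auto simp: emeasure_eq_measure intro!: ennreal_leI)
    also have "\<dots> = (\<integral>\<^sup>+\<omega>. ennreal (x ^ 3) * indicator ?E \<omega> \<partial>M)"
      by (subst nn_integral_cmult_indicator) auto
    also have "\<dots> \<le> (\<integral>\<^sup>+\<omega>. ennreal ((P 0 \<omega>) ^ 3) \<partial>M)"
    proof (intro nn_integral_mono_AE, rule AE_mp[OF dec], intro AE_I2 impI)
      fix \<omega> assume "decseq (\<lambda>i. P i \<omega>)"
      then have "P i \<omega> \<le> P 0 \<omega>" for i by (rule decseqD) simp
      then have "x \<le> P 0 \<omega>" if "\<omega> \<in> ?E" using that by (auto intro: less_imp_le order_less_le_trans)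
      then show "ennreal (x ^ 3) * indicator ?E \<omega> \<le> ennreal ((P 0 \<omega>) ^ 3)"
        using x by (auto simp: indicator_def intro!: ennreal_leI power_mono)
    qed
    finally show ?thesis .
  qed
  show ?thesis
  proof (rule ccontr)
    assume "(\<integral>\<^sup>+\<omega>. ennreal ((P 0 \<omega>) ^ 3) \<partial>M) \<noteq> \<infinity>"
    then obtain r where r: "0 \<le> r" "(\<integral>\<^sup>+\<omega>. ennreal ((P 0 \<omega>) ^ 3) \<partial>M) = ennreal r"
      by (cases "\<integral>\<^sup>+\<omega>. ennreal ((P 0 \<omega>) ^ 3) \<partial>M" rule: ennreal_cases) auto
    have "\<theta> / 16 * (16 * (r + 1) / \<theta>) \<le> r"
    proof -
      have "1 \<le> 16 * (r + 1) / \<theta>" using params r by (simp add: le_divide_eq)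
      from lower[OF this] show ?thesis using r by (simp only: r(2) ennreal_le_iff)
    qed
    then show False using params by simp
  qed
qed

section \<open>Growth of a Gaussian random walk\<close>

lemma (in prob_space) normal_even_moment:
  assumes Y: "distributed M lborel Y (normal_density 0 s)" and s: "0 < s"
  shows "(\<integral>\<^sup>+\<omega>. ennreal (Y \<omega> ^ (2 * k)) \<partial>M) = ennreal (fact (2 * k) / (2 ^ k * fact k) * s ^ (2 * k))"
proof -
  have "(\<integral>\<^sup>+\<omega>. ennreal (Y \<omega> ^ (2 * k)) \<partial>M)
      = (\<integral>\<^sup>+y. ennreal (normal_density 0 s y) * ennreal (y ^ (2 * k)) \<partial>lborel)"
    by (rule distributed_nn_integral[OF Y, symmetric]) simp
  also have "\<dots> = (\<integral>\<^sup>+y. ennreal (normal_density 0 s y * (y - 0) ^ (2 * k)) \<partial>lborel)"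
    by (simp add: ennreal_mult'[symmetric] normal_density_nonneg)
  also have "\<dots> = ennreal (fact (2 * k) / ((2 / s\<^sup>2) ^ k * fact k))"
    using normal_moment_even[OF s, of 0 k]
    by (intro nn_integral_eq_integral[THEN trans])
       (auto simp: has_bochner_integral_iff normal_density_nonneg)
  also have "fact (2 * k) / ((2 / s\<^sup>2) ^ k * fact k) = fact (2 * k) / (2 ^ k * fact k) * s ^ (2 * k)"
    using s by (simp add: power_divide power_mult)
  finally show ?thesis .
qed

lemma (in prob_space) normal_weighted_sum:
  fixes Z :: "nat \<Rightarrow> 'a \<Rightarrow> real"
  assumes indep: "indep_vars (\<lambda>_. borel) Z UNIV"
    and normal: "\<And>i. distributed M lborel (Z i) (normal_density 0 s)"
    and s: "0 < s" and c: "\<And>i. 0 < c i" and n: "0 < n"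
  shows "distributed M lborel (\<lambda>\<omega>. \<Sum>i<n. c i * Z i \<omega>) (normal_density 0 (sqrt (s\<^sup>2 * (\<Sum>i<n. (c i)\<^sup>2))))"
proof -
  have scaled: "distributed M lborel (\<lambda>\<omega>. c i * Z i \<omega>) (normal_density 0 (c i * s))" for i
    using normal_density_affine[OF normal[of i] s, of "c i" 0] c[of i] by (simp add: abs_of_pos)
  have "indep_vars (\<lambda>_. borel) (\<lambda>i \<omega>. c i * Z i \<omega>) {..<n}"
    by (rule indep_vars_subset[OF indep_vars_compose2[OF indep]]) auto
  from sum_indep_normal[OF _ _ this, of "\<lambda>i. c i * s" "\<lambda>_. 0"]
  show ?thesis using s c n scaled by (simp add: power_mult_distrib sum_distrib_left mult.commute lessThan_empty_iff)
qed

text \<open>The partial sum \<open>T n\<close> is normal with variance \<open>n s\<^sup>2\<close>, so \<open>(T n) ^ 16\<close> has mean of order \<open>n ^ 8\<close> and the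
series of \<open>(T n) ^ 16 / n ^ 10\<close> has finite mean. Its terms are therefore almost surely bounded, which
gives the exponent \<open>10 / 16 = 5/8\<close>. What matters is that this exponent is smaller than
\<open>3/4\<close>, the exponent of decay of the coefficients \<open>P i powr (3/2)\<close>.\<close>

lemma (in prob_space) AE_normal_random_walk_growth:
  fixes Z :: "nat \<Rightarrow> 'a \<Rightarrow> real"
  assumes indep: "indep_vars (\<lambda>_. borel) Z UNIV"
    and normal: "\<And>i. distributed M lborel (Z i) (normal_density 0 s)"
    and s: "0 < s"
  shows "AE \<omega> in M. \<exists>D. \<forall>n. \<bar>\<Sum>i<n. Z i \<omega>\<bar> \<le> D * real n powr (5/8)"
proof -
  have [measurable]: "Z i \<in> borel_measurable M" for i
    using normal[of i] by (auto simp: distributed_def)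
  define m :: real where "m = fact 16 / (2 ^ 8 * fact 8) * s ^ 16"
  have m: "0 \<le> m" by (simp add: m_def)
  define X where "X = (\<lambda>n \<omega>. (\<Sum>i<Suc n. Z i \<omega>) ^ 16 / real (Suc n) ^ 10)"
  have [measurable]: "X n \<in> borel_measurable M" for n by (simp add: X_def)
  have X_nonneg: "0 \<le> X n \<omega>" for n \<omega> by (simp add: X_def zero_le_power_eq)
  have moment: "(\<integral>\<^sup>+\<omega>. ennreal (X n \<omega>) \<partial>M) = ennreal (m * (1 / real (Suc n) ^ 2))" for n
  proof -
    have "distributed M lborel (\<lambda>\<omega>. \<Sum>i<Suc n. 1 * Z i \<omega>) (normal_density 0 (sqrt (s\<^sup>2 * (\<Sum>i<Suc n. 1\<^sup>2))))"
      by (intro normal_weighted_sum indep normal s) auto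
    from normal_even_moment[OF this, of 8]
    have "(\<integral>\<^sup>+\<omega>. ennreal ((\<Sum>i<Suc n. Z i \<omega>) ^ 16) \<partial>M)
        = ennreal (fact 16 / (2 ^ 8 * fact 8) * sqrt (s\<^sup>2 * real (Suc n)) ^ 16)"
      using s by (simp del: sum.lessThan_Suc of_nat_Suc fact_numeral)
    also have "sqrt (s\<^sup>2 * real (Suc n)) ^ 16 = s ^ 16 * real (Suc n) ^ 8"
      using power_mult[of "sqrt (s\<^sup>2 * real (Suc n))" 2 8] power_mult[of s 2 8]
      by (simp add: power_mult_distrib del: of_nat_Suc)
    finally have E: "(\<integral>\<^sup>+\<omega>. ennreal ((\<Sum>i<Suc n. Z i \<omega>) ^ 16) \<partial>M) = ennreal (m * real (Suc n) ^ 8)"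
      by (simp only: m_def mult.assoc)
    have "(\<integral>\<^sup>+\<omega>. ennreal (X n \<omega>) \<partial>M)
        = (\<integral>\<^sup>+\<omega>. ennreal (1 / real (Suc n) ^ 10) * ennreal ((\<Sum>i<Suc n. Z i \<omega>) ^ 16) \<partial>M)"
      by (simp add: X_def ennreal_mult'[symmetric] del: sum.lessThan_Suc)
    also have "\<dots> = ennreal (1 / real (Suc n) ^ 10) * ennreal (m * real (Suc n) ^ 8)"
      by (simp add: nn_integral_cmult E del: sum.lessThan_Suc)
    also have "\<dots> = ennreal (m * (1 / real (Suc n) ^ 2))"
    proof -
      have "1 / real (Suc n) ^ 10 * (m * real (Suc n) ^ 8) = m * (1 / real (Suc n) ^ 2)"
        by (simp add: divide_simps power_add[symmetric] del: of_nat_Suc)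
      then show ?thesis by (simp add: ennreal_mult'[symmetric])
    qed
    finally show ?thesis .
  qed
  have "summable (\<lambda>n. m * (1 / real (Suc n) ^ 2))"
    using inverse_power_summable[of 2, where 'a = real]
      summable_Suc_iff[of "\<lambda>n. 1 / real n ^ 2"]
    by (intro summable_mult) (simp add: inverse_eq_divide del: of_nat_Suc)
  then have "(\<integral>\<^sup>+\<omega>. (\<Sum>n. ennreal (X n \<omega>)) \<partial>M) \<noteq> \<infinity>"
    using m by (subst nn_integral_suminf) (auto simp: moment suminf_ennreal2)
  then have "AE \<omega> in M. summable (\<lambda>n. X n \<omega>)"
    by (intro AE_summable_if_nn_integral_finite X_nonneg) auto
  then show ?thesis
  proof (rule AE_mp, intro AE_I2 impI)
    fix \<omega> assume "summable (\<lambda>n. X n \<omega>)"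
    then obtain K where K: "\<And>n. X n \<omega> \<le> K"
      using summable_imp_bounded[of "\<lambda>n. X n \<omega>"] X_nonneg[of _ \<omega>]
      by (auto simp: bounded_iff)
    have K0: "0 \<le> K" using K[of 0] X_nonneg[of 0 \<omega>] by linarith
    have "\<bar>\<Sum>i<n. Z i \<omega>\<bar> \<le> root 16 K * real n powr (5/8)" for n
    proof (cases n)
      case (Suc k)
      have "(\<Sum>i<n. Z i \<omega>) ^ 16 \<le> K * real n ^ 10"
        using K[of k] by (simp add: X_def Suc divide_le_eq del: sum.lessThan_Suc of_nat_Suc)
      also have "\<dots> = (root 16 K * real n powr (5/8)) ^ 16"
        using K0 Suc by (simp add: power_mult_distrib powr_power powr_numeral)
      finally have "\<bar>\<Sum>i<n. Z i \<omega>\<bar> ^ 16 \<le> (root 16 K * real n powr (5/8)) ^ 16"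
        by (simp add: power_even_abs)
      then show ?thesis using K0
        by (subst (asm) power_mono_iff) auto
    qed simp
    then show "\<exists>D. \<forall>n. \<bar>\<Sum>i<n. Z i \<omega>\<bar> \<le> D * real n powr (5/8)" by blast
  qed
qed

section \<open>Convergence by summation by parts\<close>

lemma powr_Suc_diff_le:
  assumes "0 < \<beta>" "\<beta> \<le> 1"
  shows "real (Suc n) powr \<beta> - real n powr \<beta> \<le> real (Suc n) powr (\<beta> - 1)"
proof (cases n)
  case (Suc k)
  have "real n * real (Suc n) powr (\<beta> - 1) \<le> real n * real n powr (\<beta> - 1)"
    using assms Suc by (intro mult_left_mono powr_mono2') auto
  also have "\<dots> = real n powr \<beta>" using Suc by (simp add: powr_diff del: of_nat_Suc)
  finally have "real n * real (Suc n) powr (\<beta> - 1) \<le> real n powr \<beta>" .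
  moreover have "real (Suc n) powr \<beta> = (real n + 1) * real (Suc n) powr (\<beta> - 1)"
    by (simp add: powr_diff add.commute)
  ultimately show ?thesis by (simp add: algebra_simps)
qed (use assms in simp)

lemma summation_by_parts:
  fixes a z :: "nat \<Rightarrow> real"
  shows "(\<Sum>i<n. a i * z i) = (\<Sum>i<n. (a i - a (Suc i)) * (\<Sum>j<Suc i. z j)) + a n * (\<Sum>j<n. z j)"
  by (induction n) (simp_all add: algebra_simps)

text \<open>A quantitative Dirichlet test. After summation by parts the boundary term is of order
\<open>n powr (\<beta> - \<gamma>)\<close> and vanishes, and the remaining series is dominated by a multiple of
\<open>(a i - a (Suc i)) * (i + 1) powr \<beta>\<close>.
A second summation by parts turns the latter into \<open>a i\<close> times the increments of \<open>n powr \<beta>\<close>, which is of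
order \<open>i powr (\<beta> - 1 - \<gamma>)\<close>.\<close>

lemma summable_mult_of_partial_sums_growth:
  fixes a z :: "nat \<Rightarrow> real"
  assumes dec: "decseq a" and nonneg: "\<And>i. 0 \<le> a i"
    and \<beta>: "0 < \<beta>" "\<beta> < \<gamma>" "\<beta> \<le> 1"
    and a_le: "\<And>i. a i \<le> C * real (Suc i) powr (- \<gamma>)"
    and T_le: "\<And>n. \<bar>\<Sum>i<n. z i\<bar> \<le> D * real n powr \<beta>"
  shows "summable (\<lambda>i. a i * z i)"
proof -
  let ?T = "\<lambda>n. \<Sum>i<n. z i"
  have C: "0 \<le> C" using nonneg[of 0] a_le[of 0] by simp
  have D: "0 \<le> D" using T_le[of 1] by simp
  have da: "0 \<le> a i - a (Suc i)" for i using decseqD[OF dec, of i "Suc i"] by simp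
  have B_sum: "summable (\<lambda>i. C * real (Suc i) powr (\<beta> - 1 - \<gamma>))"
    using \<beta> summable_Suc_iff[of "\<lambda>i. real i powr (\<beta> - 1 - \<gamma>)"]
    by (intro summable_mult) (simp add: summable_real_powr_iff del: of_nat_Suc)
  have partial: "(\<Sum>i<n. (a i - a (Suc i)) * real (Suc i) powr \<beta>) \<le> (\<Sum>i. C * real (Suc i) powr (\<beta> - 1 - \<gamma>))" for n
  proof -
    have tele: "(\<Sum>j<n. real (Suc j) powr \<beta> - real j powr \<beta>) = real n powr \<beta>" for n
      by (induction n) auto
    have "(\<Sum>i<n. (a i - a (Suc i)) * real (Suc i) powr \<beta>) + a n * real n powr \<beta>
       = (\<Sum>i<n. a i * (real (Suc i) powr \<beta> - real i powr \<beta>))"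
      using summation_by_parts[of a "\<lambda>j. real (Suc j) powr \<beta> - real j powr \<beta>" n] 
      by (simp only: tele)
    also have "\<dots> \<le> (\<Sum>i<n. C * real (Suc i) powr (\<beta> - 1 - \<gamma>))"
    proof (intro sum_mono)
      fix i
      have "a i * (real (Suc i) powr \<beta> - real i powr \<beta>) \<le> a i * real (Suc i) powr (\<beta> - 1)"
        using \<beta> by (intro mult_left_mono powr_Suc_diff_le nonneg) auto
      also have "\<dots> \<le> C * real (Suc i) powr (- \<gamma>) * real (Suc i) powr (\<beta> - 1)"
        by (intro mult_right_mono a_le) auto
      also have "\<dots> = C * real (Suc i) powr (\<beta> - 1 - \<gamma>)"
        by (simp add: mult.assoc powr_add[symmetric] del: of_nat_Suc)
      finally show "a i * (real (Suc i) powr \<beta> - real i powr \<beta>) \<le> C * real (Suc i) powr (\<beta> - 1 - \<gamma>)" .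
    qed
    also have "\<dots> \<le> (\<Sum>i. C * real (Suc i) powr (\<beta> - 1 - \<gamma>))"
      using C by (intro sum_le_suminf B_sum) auto
    moreover have "0 \<le> a n * real n powr \<beta>" using nonneg by simp
    ultimately show ?thesis by linarith
  qed
  have "summable (\<lambda>i. (a i - a (Suc i)) * real (Suc i) powr \<beta>)"
    by (rule bounded_imp_summable[OF _ partial[of "Suc _", unfolded lessThan_Suc_atMost]])
       (use da in auto)
  then have "summable (\<lambda>i. D * ((a i - a (Suc i)) * real (Suc i) powr \<beta>))" by (rule summable_mult)
  then have main: "summable (\<lambda>i. (a i - a (Suc i)) * ?T (Suc i))"
  proof (rule summable_comparison_test[rotated], intro exI allI impI)
    fix i
    show "norm ((a i - a (Suc i)) * ?T (Suc i)) \<le> D * ((a i - a (Suc i)) * real (Suc i) powr \<beta>)"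
      using mult_left_mono[OF T_le[of "Suc i"] da[of i]] da[of i]
      by (simp add: abs_mult mult_ac del: sum.lessThan_Suc of_nat_Suc)
  qed
  have boundary: "(\<lambda>n. a n * ?T n) \<longlonglongrightarrow> 0"
  proof (rule Lim_null_comparison)
    show "\<forall>\<^sub>F n in sequentially. norm (a n * ?T n) \<le> C * D * real (Suc n) powr (\<beta> - \<gamma>)"
    proof (intro always_eventually allI)
      fix n
      have "norm (a n * ?T n) \<le> (C * real (Suc n) powr (- \<gamma>)) * (D * real (Suc n) powr \<beta>)"
        unfolding norm_mult
      proof (intro mult_mono)
        show "norm (a n) \<le> C * real (Suc n) powr (- \<gamma>)" using a_le[of n] nonneg[of n] by simp
        have "D * real n powr \<beta> \<le> D * real (Suc n) powr \<beta>"
          using D \<beta> by (intro mult_left_mono powr_mono2) auto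
        then show "norm (?T n) \<le> D * real (Suc n) powr \<beta>" using T_le[of n] by simp
      qed (use C in auto)
      also have "\<dots> = C * D * (real (Suc n) powr (- \<gamma>) * real (Suc n) powr \<beta>)" by (simp add: mult_ac)
      also have "\<dots> = C * D * real (Suc n) powr (\<beta> - \<gamma>)" by (simp only: powr_add[symmetric]) simp
      finally show "norm (a n * ?T n) \<le> C * D * real (Suc n) powr (\<beta> - \<gamma>)" .
    qed
    have "(\<lambda>n. real (Suc n) powr (\<beta> - \<gamma>)) \<longlonglongrightarrow> 0"
      using \<beta> by (intro tendsto_neg_powr filterlim_compose[OF filterlim_real_sequentially filterlim_Suc]) auto
    from tendsto_mult_right_zero[OF this]
    show "(\<lambda>n. C * D * real (Suc n) powr (\<beta> - \<gamma>)) \<longlonglongrightarrow> 0" .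
  qed
  have "(\<lambda>n. (\<Sum>i<n. (a i - a (Suc i)) * ?T (Suc i)) + a n * ?T n) \<longlonglongrightarrow> (\<Sum>i. (a i - a (Suc i)) * ?T (Suc i)) + 0"
    by (intro tendsto_add summable_LIMSEQ main boundary)
  then have "(\<lambda>i. a i * z i) sums ((\<Sum>i. (a i - a (Suc i)) * ?T (Suc i)) + 0)"
    unfolding sums_def by (simp only: summation_by_parts[symmetric])
  then show ?thesis by (rule sums_summable)
qed

text \<open>Monotonicity gives \<open>(i + 1) (p i)\<^sup>2 \<le> \<Sum>j. (p j)\<^sup>2\<close>.\<close>

lemma decseq_square_summable_decay:
  fixes p :: "nat \<Rightarrow> real"
  assumes dec: "decseq p" and pos: "\<And>i. 0 < p i" and summ: "summable (\<lambda>i. (p i)\<^sup>2)"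
  shows "p i powr (3/2) \<le> (\<Sum>i. (p i)\<^sup>2) powr (3/4) * real (Suc i) powr (- (3/4))"
proof -
  let ?A = "\<Sum>i. (p i)\<^sup>2"
  have "real (Suc i) * (p i)\<^sup>2 = (\<Sum>j<Suc i. (p i)\<^sup>2)" by simp
  also have "\<dots> \<le> (\<Sum>j<Suc i. (p j)\<^sup>2)"
    using pos[of i] by (intro sum_mono power_mono decseqD[OF dec]) auto
  also have "\<dots> \<le> ?A" by (intro sum_le_suminf summ) auto
  finally have "(p i)\<^sup>2 \<le> ?A * real (Suc i) powr (- 1)"
    by (simp add: powr_minus divide_simps mult.commute del: of_nat_Suc)
  then have "(p i)\<^sup>2 powr (3/4) \<le> (?A * real (Suc i) powr (- 1)) powr (3/4)"
    by (rule powr_mono2[rotated 2]) auto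
  also have "(p i)\<^sup>2 powr (3/4) = p i powr (3/2)"
    using pos[of i] by (simp add: powr_numeral[symmetric] powr_powr del: powr_numeral)
  also have "(?A * real (Suc i) powr (- 1)) powr (3/4) = ?A powr (3/4) * real (Suc i) powr (- (3/4))"
    by (subst powr_mult) (simp_all only: powr_powr suminf_nonneg summ zero_le_power2 powr_ge_zero, simp_all)
  finally show ?thesis .
qed

section \<open>Independence and joint laws\<close>

lemma (in prob_space) nn_integral_indep_var:
  assumes indep: "indep_var S X T Y" and h[measurable]: "h \<in> borel_measurable (S \<Otimes>\<^sub>M T)"
  shows "(\<integral>\<^sup>+\<omega>. h (X \<omega>, Y \<omega>) \<partial>M) = (\<integral>\<^sup>+\<omega>. (\<integral>\<^sup>+\<omega>'. h (X \<omega>, Y \<omega>') \<partial>M) \<partial>M)"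
proof -
  have [measurable]: "X \<in> measurable M S" "Y \<in> measurable M T"
    using indep by (auto dest: indep_var_rv1 indep_var_rv2)
  interpret Y: prob_space "distr M T Y" by (rule prob_space_distr) simp
  have h': "h \<in> borel_measurable (distr M S X \<Otimes>\<^sub>M distr M T Y)" by simp
  have "(\<integral>\<^sup>+\<omega>. h (X \<omega>, Y \<omega>) \<partial>M) = (\<integral>\<^sup>+x. h x \<partial>distr M (S \<Otimes>\<^sub>M T) (\<lambda>\<omega>. (X \<omega>, Y \<omega>)))"
    by (subst nn_integral_distr) auto
  also have "\<dots> = (\<integral>\<^sup>+x. h x \<partial>(distr M S X \<Otimes>\<^sub>M distr M T Y))"
    using indep by (simp add: indep_var_distribution_eq)
  also have "\<dots> = (\<integral>\<^sup>+x. (\<integral>\<^sup>+y. h (x, y) \<partial>distr M T Y) \<partial>distr M S X)"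
    by (rule Y.nn_integral_fst[OF h', symmetric])
  also have "\<dots> = (\<integral>\<^sup>+\<omega>. (\<integral>\<^sup>+y. h (X \<omega>, y) \<partial>distr M T Y) \<partial>M)"
    using Y.borel_measurable_nn_integral_fst[OF h'] by (subst nn_integral_distr) auto
  also have "\<dots> = (\<integral>\<^sup>+\<omega>. (\<integral>\<^sup>+\<omega>'. h (X \<omega>, Y \<omega>') \<partial>M) \<partial>M)"
    by (intro nn_integral_cong) (auto simp: nn_integral_distr measurable_space[where f = X])
  finally show ?thesis .
qed

lemma indep_var_cong_joint_law:
  assumes M: "prob_space M" and N: "prob_space N"
    and [measurable]: "X \<in> measurable M S" "Y \<in> measurable M T" "X' \<in> measurable N S" "Y' \<in> measurable N T"
    and law: "distr M (S \<Otimes>\<^sub>M T) (\<lambda>\<omega>. (X \<omega>, Y \<omega>)) = distr N (S \<Otimes>\<^sub>M T) (\<lambda>\<omega>. (X' \<omega>, Y' \<omega>))"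
    and indep: "prob_space.indep_var M S X T Y"
  shows "prob_space.indep_var N S X' T Y'"
proof -
  have "distr M S X = distr N S X'"
    using arg_cong[OF law, of "\<lambda>L. distr L S fst"] by (simp add: distr_distr comp_def)
  moreover have "distr M T Y = distr N T Y'"
    using arg_cong[OF law, of "\<lambda>L. distr L T snd"] by (simp add: distr_distr comp_def)
  ultimately show ?thesis
    using indep law by (simp add: prob_space.indep_var_distribution_eq[OF M] prob_space.indep_var_distribution_eq[OF N])
qed

section \<open>Points with independent Gaussian weights\<close>

abbreviation sequences :: "(nat \<Rightarrow> real) measure" where
  "sequences \<equiv> PiM UNIV (\<lambda>_. borel)"

definition flip_first :: "(nat \<Rightarrow> real) \<Rightarrow> nat \<Rightarrow> real" where
  "flip_first z = (\<lambda>i. if i = 0 then - z i else z i)"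

lemma measurable_flip_first[measurable]: "flip_first \<in> measurable sequences sequences"
  unfolding flip_first_def by (rule measurable_abs_UNIV) measurable

locale normally_weighted_points = prob_space M for M :: "'b measure" +
  fixes P Z :: "nat \<Rightarrow> 'b \<Rightarrow> real" and s :: real
  assumes s: "0 < s"
    and P_measurable[measurable]: "\<And>i. P i \<in> borel_measurable M"
    and P_pos: "\<And>i \<omega>. \<omega> \<in> space M \<Longrightarrow> 0 < P i \<omega>"
    and Z_normal: "\<And>i. distributed M lborel (Z i) (normal_density 0 s)"
    and Z_indep: "indep_vars (\<lambda>_. borel) Z UNIV"
    and PZ_indep: "indep_var sequences (\<lambda>\<omega> i. P i \<omega>) sequences (\<lambda>\<omega> i. Z i \<omega>)"
begin

lemma Z_measurable[measurable]: "Z i \<in> borel_measurable M"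
  using Z_normal[of i] by (auto simp: distributed_def)

text \<open>Given the points, the partial sum is a centred normal variable with variance \<open>s\<^sup>2 * (\<Sum>i<n. (P i) ^ 3)\<close>.
The factor \<open>g\<close> makes it possible to restrict to events that depend on the points only.\<close>

lemma second_moment_partial_sum:
  assumes [measurable]: "g \<in> borel_measurable sequences"
  shows "(\<integral>\<^sup>+\<omega>. g (\<lambda>i. P i \<omega>) * ennreal ((\<Sum>i<n. P i \<omega> powr (3/2) * Z i \<omega>)\<^sup>2) \<partial>M)
    = (\<integral>\<^sup>+\<omega>. g (\<lambda>i. P i \<omega>) * ennreal (s\<^sup>2 * (\<Sum>i<n. (P i \<omega>) ^ 3)) \<partial>M)"
proof -
  let ?h = "\<lambda>(p, z). g p * ennreal ((\<Sum>i<n. p i powr (3/2) * z i)\<^sup>2)"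
  have [measurable]: "?h \<in> borel_measurable (sequences \<Otimes>\<^sub>M sequences)" by measurable
  have inner: "(\<integral>\<^sup>+\<omega>'. ennreal ((\<Sum>i<n. P i \<omega> powr (3/2) * Z i \<omega>')\<^sup>2) \<partial>M)
      = ennreal (s\<^sup>2 * (\<Sum>i<n. (P i \<omega>) ^ 3))" if \<omega>: "\<omega> \<in> space M" for \<omega>
  proof (cases "n = 0")
    case False
    let ?c = "\<lambda>i. P i \<omega> powr (3/2)"
    have c: "0 < ?c i" "(?c i)\<^sup>2 = (P i \<omega>) ^ 3" for i
      using P_pos[OF \<omega>, of i] by (simp_all add: powr_power powr_numeral)
    have pos: "0 < s\<^sup>2 * (\<Sum>i<n. (P i \<omega>) ^ 3)"
      using s P_pos[OF \<omega>] False by (intro mult_pos_pos sum_pos) auto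
    have "distributed M lborel (\<lambda>\<omega>'. \<Sum>i<n. ?c i * Z i \<omega>') (normal_density 0 (sqrt (s\<^sup>2 * (\<Sum>i<n. (?c i)\<^sup>2))))"
      using False c(1) by (intro normal_weighted_sum Z_indep Z_normal s) auto
    from normal_even_moment[OF this, of 1] show ?thesis
      using pos by (simp add: c(2))
  qed simp
  have "(\<integral>\<^sup>+\<omega>. ?h (\<lambda>i. P i \<omega>, \<lambda>i. Z i \<omega>) \<partial>M)
      = (\<integral>\<^sup>+\<omega>. (\<integral>\<^sup>+\<omega>'. ?h (\<lambda>i. P i \<omega>, \<lambda>i. Z i \<omega>') \<partial>M) \<partial>M)"
    by (rule nn_integral_indep_var[OF PZ_indep]) measurable
  also have "\<dots> = (\<integral>\<^sup>+\<omega>. g (\<lambda>i. P i \<omega>) * ennreal (s\<^sup>2 * (\<Sum>i<n. (P i \<omega>) ^ 3)) \<partial>M)"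
    by (intro nn_integral_cong) (simp add: nn_integral_cmult inner)
  finally show ?thesis by simp
qed

text \<open>The normal law is symmetric, so changing the sign of the first weight does not change the law of the
weights, nor their joint law with the independent points.\<close>

lemma flip_first_invariant:
  assumes h[measurable]: "h \<in> borel_measurable (sequences \<Otimes>\<^sub>M sequences)"
  shows "(\<integral>\<^sup>+\<omega>. h (\<lambda>i. P i \<omega>, flip_first (\<lambda>i. Z i \<omega>)) \<partial>M) = (\<integral>\<^sup>+\<omega>. h (\<lambda>i. P i \<omega>, \<lambda>i. Z i \<omega>) \<partial>M)"
proof -
  define Z' where "Z' = (\<lambda>i \<omega>. if i = 0 then - Z i \<omega> else Z i \<omega>)"
  have [measurable]: "Z' i \<in> borel_measurable M" for i by (simp add: Z'_def)
  have flip_Z: "flip_first (\<lambda>i. Z i \<omega>) = (\<lambda>i. Z' i \<omega>)" for \<omega>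
    by (auto simp: flip_first_def Z'_def)
  have "distributed M lborel (\<lambda>\<omega>. - Z 0 \<omega>) (normal_density 0 s)"
    using normal_density_affine[OF Z_normal[of 0] s, of "-1" 0] by simp
  then have Z'_normal: "distributed M lborel (Z' i) (normal_density 0 s)" for i
    using Z_normal[of i] by (cases "i = 0") (auto simp: Z'_def)
  have law: "distr M borel X = density lborel (normal_density 0 s)"
    if "distributed M lborel X (normal_density 0 s)" for X
    using distributed_distr_eq_density[OF that] by (simp add: distr_cong[OF refl sets_lborel] cong: distr_cong)
  have "indep_vars (\<lambda>_. borel) (\<lambda>i \<omega>. (if i = 0 then uminus else id) (Z i \<omega>)) UNIV"
    by (rule indep_vars_compose2[OF Z_indep]) auto
  also have "(\<lambda>i \<omega>. (if i = 0 then uminus else id) (Z i \<omega>)) = Z'"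
    by (auto simp: Z'_def fun_eq_iff)
  finally have Z'_indep: "indep_vars (\<lambda>_. borel) Z' UNIV" .
  have "distr M sequences (\<lambda>\<omega> i. Z i \<omega>) = PiM UNIV (\<lambda>i. distr M borel (Z i))"
    using indep_vars_iff_distr_eq_PiM[of UNIV Z "\<lambda>_. borel"] Z_indep by (simp add: restrict_def)
  also have "\<dots> = PiM UNIV (\<lambda>i. distr M borel (Z' i))"
    by (simp add: law Z_normal Z'_normal)
  also have "\<dots> = distr M sequences (\<lambda>\<omega> i. Z' i \<omega>)"
    using indep_vars_iff_distr_eq_PiM[of UNIV Z' "\<lambda>_. borel"] Z'_indep by (simp add: restrict_def)
  finally have laws: "distr M sequences (\<lambda>\<omega> i. Z i \<omega>) = distr M sequences (\<lambda>\<omega> i. Z' i \<omega>)" .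
  have "indep_var sequences (id \<circ> (\<lambda>\<omega> i. P i \<omega>)) sequences (flip_first \<circ> (\<lambda>\<omega> i. Z i \<omega>))"
    by (rule indep_var_compose[OF PZ_indep]) auto
  then have PZ'_indep: "indep_var sequences (\<lambda>\<omega> i. P i \<omega>) sequences (\<lambda>\<omega> i. Z' i \<omega>)"
    by (simp add: comp_def flip_Z)
  have Zm: "(\<lambda>\<omega> i. Z i \<omega>) \<in> measurable M sequences" "(\<lambda>\<omega> i. Z' i \<omega>) \<in> measurable M sequences"
    by (auto intro!: measurable_abs_UNIV)
  have "(\<integral>\<^sup>+\<omega>'. h (\<lambda>i. P i \<omega>, \<lambda>i. Z' i \<omega>') \<partial>M) = (\<integral>\<^sup>+\<omega>'. h (\<lambda>i. P i \<omega>, \<lambda>i. Z i \<omega>') \<partial>M)" for \<omega>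
  proof -
    have hm: "(\<lambda>z. h (\<lambda>i. P i \<omega>, z)) \<in> borel_measurable sequences"
      by (rule measurable_compose[OF _ h]) (simp add: space_PiM)
    show ?thesis
      using nn_integral_distr[OF Zm(1), of "\<lambda>z. h (\<lambda>i. P i \<omega>, z)"]
        nn_integral_distr[OF Zm(2), of "\<lambda>z. h (\<lambda>i. P i \<omega>, z)"] hm laws by simp
  qed
  then show ?thesis
    unfolding flip_Z
    using nn_integral_indep_var[OF PZ_indep h] nn_integral_indep_var[OF PZ'_indep h] by simp
qed

text \<open>The convergence may be only conditional: for Poisson points of intensity \<open>\<theta> * \<alpha> * y powr (- \<alpha> - 1)\<close> with
\<open>\<alpha> \<ge> 3/2\<close>, the coefficients \<open>P i powr (3/2)\<close> are not summable.
Outside the null sets of points that are not square summable or not ordered, and of weights whose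
partial sums grow too fast, it holds for each outcome by the Dirichlet test.\<close>

lemma AE_summable_weighted_sum:
  assumes A: "AE \<omega> in M. summable (\<lambda>i. (P i \<omega>)\<^sup>2)"
    and dec: "AE \<omega> in M. decseq (\<lambda>i. P i \<omega>)"
  shows "AE \<omega> in M. summable (\<lambda>i. P i \<omega> powr (3/2) * Z i \<omega>)"
  using A dec AE_normal_random_walk_growth[OF Z_indep Z_normal s] AE_space
proof eventually_elim
  case (elim \<omega>)
  from elim(3) obtain D where D: "\<And>n. \<bar>\<Sum>i<n. Z i \<omega>\<bar> \<le> D * real n powr (5/8)" by blast
  show ?case
  proof (rule summable_mult_of_partial_sums_growth[OF _ _ _ _ _ _ D])
    show "decseq (\<lambda>i. P i \<omega> powr (3/2))"
      using elim(2) P_pos[OF elim(4), THEN less_imp_le] by (auto simp: decseq_def intro!: powr_mono2)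
    show "P i \<omega> powr (3/2) \<le> (\<Sum>i. (P i \<omega>)\<^sup>2) powr (3/4) * real (Suc i) powr (- (3/4))" for i
      using elim P_pos by (intro decseq_square_summable_decay) auto
  qed auto
qed

text \<open>If \<open>\<Sum>i. (P i)\<^sup>2 \<le> K\<close>, then each point is at most \<open>sqrt K\<close> and \<open>\<Sum>i. (P i) ^ 3 \<le> sqrt K * K\<close>, which bounds
the conditional variance of all partial sums. Fatou's lemma passes the bound to the limit.\<close>

lemma second_moment_given_small_points:
  assumes A: "AE \<omega> in M. summable (\<lambda>i. (P i \<omega>)\<^sup>2)"
    and S: "AE \<omega> in M. summable (\<lambda>i. P i \<omega> powr (3/2) * Z i \<omega>)"
    and K: "0 \<le> K"
  shows "(\<integral>\<^sup>+\<omega>. indicator {..K} (\<Sum>i. (P i \<omega>)\<^sup>2) * ennreal ((\<Sum>i. P i \<omega> powr (3/2) * Z i \<omega>)\<^sup>2) \<partial>M)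
    \<le> ennreal (s\<^sup>2 * (sqrt K * K))"
proof -
  let ?I = "\<lambda>\<omega>. indicator {..K} (\<Sum>i. (P i \<omega>)\<^sup>2) :: ennreal"
  let ?S = "\<lambda>n \<omega>. \<Sum>i<n. P i \<omega> powr (3/2) * Z i \<omega>"
  have bound: "(\<integral>\<^sup>+\<omega>. ?I \<omega> * ennreal ((?S n \<omega>)\<^sup>2) \<partial>M) \<le> ennreal (s\<^sup>2 * (sqrt K * K))" for n
  proof -
    have "(\<integral>\<^sup>+\<omega>. ?I \<omega> * ennreal ((?S n \<omega>)\<^sup>2) \<partial>M)
        = (\<integral>\<^sup>+\<omega>. ?I \<omega> * ennreal (s\<^sup>2 * (\<Sum>i<n. (P i \<omega>) ^ 3)) \<partial>M)"
      by (rule second_moment_partial_sum[where g = "\<lambda>p. indicator {..K} (\<Sum>i. (p i)\<^sup>2)"]) measurable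
    also have "\<dots> \<le> (\<integral>\<^sup>+\<omega>. ennreal (s\<^sup>2 * (sqrt K * K)) \<partial>M)"
    proof (intro nn_integral_mono_AE, rule AE_mp[OF A], intro AE_I2 impI)
      fix \<omega> assume \<omega>: "\<omega> \<in> space M" and summ: "summable (\<lambda>i. (P i \<omega>)\<^sup>2)"
      have "(\<Sum>i<n. (P i \<omega>) ^ 3) \<le> sqrt K * K" if AK: "(\<Sum>i. (P i \<omega>)\<^sup>2) \<le> K"
      proof -
        have "(P i \<omega>)\<^sup>2 \<le> K" for i
          using sum_le_suminf[OF summ, of "{i}"] AK by simp
        then have "P i \<omega> \<le> sqrt K" for i by (intro real_le_rsqrt)
        then have "(\<Sum>i<n. (P i \<omega>) ^ 3) \<le> (\<Sum>i<n. sqrt K * (P i \<omega>)\<^sup>2)"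
          by (intro sum_mono) (auto simp: power3_eq_cube power2_eq_square mult.assoc intro!: mult_right_mono)
        also have "\<dots> \<le> sqrt K * (\<Sum>i. (P i \<omega>)\<^sup>2)"
          unfolding sum_distrib_left[symmetric] using K by (intro mult_left_mono sum_le_suminf summ) auto
        also have "\<dots> \<le> sqrt K * K" using AK K by (intro mult_left_mono) auto
        finally show ?thesis .
      qed
      then show "?I \<omega> * ennreal (s\<^sup>2 * (\<Sum>i<n. (P i \<omega>) ^ 3)) \<le> ennreal (s\<^sup>2 * (sqrt K * K))"
        by (auto simp: indicator_def intro!: ennreal_leI mult_left_mono)
    qed
    finally show ?thesis by (simp add: emeasure_space_1)
  qed
  have "(\<integral>\<^sup>+\<omega>. ?I \<omega> * ennreal ((\<Sum>i. P i \<omega> powr (3/2) * Z i \<omega>)\<^sup>2) \<partial>M)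
      = (\<integral>\<^sup>+\<omega>. liminf (\<lambda>n. ?I \<omega> * ennreal ((?S n \<omega>)\<^sup>2)) \<partial>M)"
  proof (intro nn_integral_cong_AE, rule AE_mp[OF S], intro AE_I2 impI)
    fix \<omega> assume "summable (\<lambda>i. P i \<omega> powr (3/2) * Z i \<omega>)"
    then have "(\<lambda>n. ?S n \<omega>) \<longlonglongrightarrow> (\<Sum>i. P i \<omega> powr (3/2) * Z i \<omega>)" by (rule summable_LIMSEQ)
    then have "(\<lambda>n. ?I \<omega> * ennreal ((?S n \<omega>)\<^sup>2)) \<longlonglongrightarrow> ?I \<omega> * ennreal ((\<Sum>i. P i \<omega> powr (3/2) * Z i \<omega>)\<^sup>2)"
      by (intro ennreal_tendsto_cmult tendsto_ennrealI tendsto_power) (auto simp: indicator_def)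
    then show "?I \<omega> * ennreal ((\<Sum>i. P i \<omega> powr (3/2) * Z i \<omega>)\<^sup>2) = liminf (\<lambda>n. ?I \<omega> * ennreal ((?S n \<omega>)\<^sup>2))"
      by (intro lim_imp_Liminf[symmetric]) auto
  qed
  also have "\<dots> \<le> liminf (\<lambda>n. \<integral>\<^sup>+\<omega>. ?I \<omega> * ennreal ((?S n \<omega>)\<^sup>2) \<partial>M)"
    by (intro nn_integral_liminf) measurable
  also have "\<dots> \<le> ennreal (s\<^sup>2 * (sqrt K * K))"
    by (intro Liminf_le always_eventually allI bound) auto
  finally show ?thesis .
qed

text \<open>Flipping the first sign changes the series \<open>S\<close> into a series \<open>S'\<close> with the same law, and
\<open>S - S' = 2 * P 0 powr (3/2) * Z 0\<close>. So \<open>(P 0) ^ 3 * (Z 0)\<^sup>2 \<le> S\<^sup>2 + S'\<^sup>2\<close>, and the mean of \<open>S\<^sup>2\<close>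
inherits the divergence of the third moment of \<open>P 0\<close>. This comparison avoids computing the second
moment of the limit.\<close>

lemma second_moment_infinite:
  assumes S: "AE \<omega> in M. summable (\<lambda>i. P i \<omega> powr (3/2) * Z i \<omega>)"
    and P0: "(\<integral>\<^sup>+\<omega>. ennreal ((P 0 \<omega>) ^ 3) \<partial>M) = \<infinity>"
  shows "(\<integral>\<^sup>+\<omega>. ennreal ((\<Sum>i. P i \<omega> powr (3/2) * Z i \<omega>)\<^sup>2) \<partial>M) = \<infinity>"
proof -
  let ?h = "\<lambda>(p, z). ennreal ((\<Sum>i. p i powr (3/2) * z i)\<^sup>2)"
  let ?f = "\<lambda>\<omega> i. P i \<omega> powr (3/2) * Z i \<omega>" and ?f' = "\<lambda>\<omega> i. P i \<omega> powr (3/2) * flip_first (\<lambda>i. Z i \<omega>) i"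
  have [measurable]: "(\<lambda>\<omega>. flip_first (\<lambda>i. Z i \<omega>) i) \<in> borel_measurable M" for i
    unfolding flip_first_def by measurable
  have flip: "(\<integral>\<^sup>+\<omega>. ennreal ((\<Sum>i. ?f' \<omega> i)\<^sup>2) \<partial>M) = (\<integral>\<^sup>+\<omega>. ennreal ((\<Sum>i. ?f \<omega> i)\<^sup>2) \<partial>M)"
    using flip_first_invariant[of ?h] by simp
  have "ennreal (s\<^sup>2) * (\<integral>\<^sup>+\<omega>. ennreal ((P 0 \<omega>) ^ 3) \<partial>M)
      = (\<integral>\<^sup>+\<omega>. ennreal (s\<^sup>2 * (P 0 \<omega>) ^ 3) \<partial>M)"
    by (simp add: nn_integral_cmult[symmetric] ennreal_mult')
  also have "\<dots> = (\<integral>\<^sup>+\<omega>. ennreal ((?f \<omega> 0)\<^sup>2) \<partial>M)"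
    using second_moment_partial_sum[of "\<lambda>_. 1" 1] by simp
  also have "\<dots> \<le> (\<integral>\<^sup>+\<omega>. ennreal ((\<Sum>i. ?f \<omega> i)\<^sup>2) + ennreal ((\<Sum>i. ?f' \<omega> i)\<^sup>2) \<partial>M)"
  proof (intro nn_integral_mono_AE, rule AE_mp[OF S], intro AE_I2 impI)
    fix \<omega> assume "summable (?f \<omega>)"
    then have "(\<lambda>i. ?f \<omega> i - (if i = 0 then 2 * ?f \<omega> 0 else 0)) sums ((\<Sum>i. ?f \<omega> i) - 2 * ?f \<omega> 0)"
      by (intro sums_diff summable_sums sums_single)
    also have "(\<lambda>i. ?f \<omega> i - (if i = 0 then 2 * ?f \<omega> 0 else 0)) = ?f' \<omega>"
      by (auto simp: flip_first_def)
    finally have "2 * ?f \<omega> 0 = (\<Sum>i. ?f \<omega> i) - (\<Sum>i. ?f' \<omega> i)"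
      by (simp add: sums_iff)
    then have "?f \<omega> 0 = ((\<Sum>i. ?f \<omega> i) - (\<Sum>i. ?f' \<omega> i)) / 2" by simp
    moreover have "((x - y) / 2)\<^sup>2 \<le> x\<^sup>2 + y\<^sup>2" for x y :: real
    proof -
      have "x\<^sup>2 + y\<^sup>2 - ((x - y) / 2)\<^sup>2 = ((x + y) / 2)\<^sup>2 + (x\<^sup>2 + y\<^sup>2) / 2"
        by (simp add: power2_eq_square field_simps)
      moreover have "0 \<le> ((x + y) / 2)\<^sup>2 + (x\<^sup>2 + y\<^sup>2) / 2" by simp
      ultimately show ?thesis by linarith
    qed
    ultimately have "(?f \<omega> 0)\<^sup>2 \<le> (\<Sum>i. ?f \<omega> i)\<^sup>2 + (\<Sum>i. ?f' \<omega> i)\<^sup>2" by (simp only:)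
    then show "ennreal ((?f \<omega> 0)\<^sup>2) \<le> ennreal ((\<Sum>i. ?f \<omega> i)\<^sup>2) + ennreal ((\<Sum>i. ?f' \<omega> i)\<^sup>2)"
      by (simp add: ennreal_plus[symmetric] ennreal_leI del: ennreal_plus)
  qed
  also have "\<dots> = (\<integral>\<^sup>+\<omega>. ennreal ((\<Sum>i. ?f \<omega> i)\<^sup>2) \<partial>M) + (\<integral>\<^sup>+\<omega>. ennreal ((\<Sum>i. ?f \<omega> i)\<^sup>2) \<partial>M)"
    by (subst nn_integral_add) (auto simp: flip)
  finally have "\<infinity> \<le> (\<integral>\<^sup>+\<omega>. ennreal ((\<Sum>i. ?f \<omega> i)\<^sup>2) \<partial>M) + (\<integral>\<^sup>+\<omega>. ennreal ((\<Sum>i. ?f \<omega> i)\<^sup>2) \<partial>M)"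
    using s by (simp add: P0 ennreal_mult_top)
  then show ?thesis by (simp add: top_unique)
qed

text \<open>Under independence, restricting to \<open>{\<Sum>i. (P i)\<^sup>2 \<le> K}\<close> would only multiply the second moment of the weighted
sum by the probability of that event. The restricted moment is finite and the full one is infinite, so
the event would be a null set for every \<open>K\<close>, which is impossible for a real-valued variable.\<close>

lemma not_indep_sums:
  assumes A: "AE \<omega> in M. summable (\<lambda>i. (P i \<omega>)\<^sup>2)"
    and dec: "AE \<omega> in M. decseq (\<lambda>i. P i \<omega>)"
    and P0: "(\<integral>\<^sup>+\<omega>. ennreal ((P 0 \<omega>) ^ 3) \<partial>M) = \<infinity>"
  shows "\<not> indep_var borel (\<lambda>\<omega>. \<Sum>i. (P i \<omega>)\<^sup>2) borel (\<lambda>\<omega>. \<Sum>i. P i \<omega> powr (3/2) * Z i \<omega>)"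
proof
  let ?A = "\<lambda>\<omega>. \<Sum>i. (P i \<omega>)\<^sup>2" and ?S = "\<lambda>\<omega>. \<Sum>i. P i \<omega> powr (3/2) * Z i \<omega>"
  assume indep: "indep_var borel ?A borel ?S"
  note S = AE_summable_weighted_sum[OF A dec]
  have prob_small: "emeasure M {\<omega> \<in> space M. ?A \<omega> \<le> K} = 0" if "0 \<le> K" for K
  proof (rule ccontr)
    assume nz: "emeasure M {\<omega> \<in> space M. ?A \<omega> \<le> K} \<noteq> 0"
    let ?h = "\<lambda>(x, y). indicator {..K} x * ennreal (y\<^sup>2)"
    have "(\<integral>\<^sup>+\<omega>. ?h (?A \<omega>, ?S \<omega>) \<partial>M) = (\<integral>\<^sup>+\<omega>. (\<integral>\<^sup>+\<omega>'. ?h (?A \<omega>, ?S \<omega>') \<partial>M) \<partial>M)"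
      by (rule nn_integral_indep_var[OF indep]) measurable
    also have "\<dots> = (\<integral>\<^sup>+\<omega>. indicator {\<omega> \<in> space M. ?A \<omega> \<le> K} \<omega> * \<infinity> \<partial>M)"
      by (intro nn_integral_cong) (auto simp: nn_integral_cmult second_moment_infinite[OF S P0] indicator_def)
    also have "\<dots> = emeasure M {\<omega> \<in> space M. ?A \<omega> \<le> K} * \<infinity>"
      by (subst nn_integral_multc) auto
    finally show False
      using second_moment_given_small_points[OF A S \<open>0 \<le> K\<close>] nz by (simp add: ennreal_mult_top top_unique)
  qed
  have "emeasure M (\<Union>n::nat. {\<omega> \<in> space M. ?A \<omega> \<le> real n}) = 0"
    by (intro emeasure_UN_eq_0) (auto simp: prob_small)
  also have "(\<Union>n::nat. {\<omega> \<in> space M. ?A \<omega> \<le> real n}) = space M"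
    using real_arch_simple by auto
  finally show False by (simp add: emeasure_space_1)
qed
end

section \<open>Dependence of the two limit variables\<close>

theorem proposition5p4:
  fixes \<alpha> \<mu> \<sigma>2 \<theta> :: real
    and M :: "'a measure" and V1 V2 :: "'a \<Rightarrow> real"
    and \<Omega> :: "'b measure" and P Z :: "nat \<Rightarrow> 'b \<Rightarrow> real"
  assumes "1 < \<alpha>" "\<alpha> < 2"
    and "0 < \<mu>" "\<mu> < 1"
    and "0 < \<sigma>2"
    and "\<theta> = 1 - \<mu> powr \<alpha>"
    and "prob_space \<Omega>"
    and "\<And>i. P i \<in> measurable \<Omega> (restrict_space borel {0<..})"
    and "poisson_point_process \<Omega>
           (\<lambda>\<omega>. sum_dirac (restrict_space borel {0<..}) (\<lambda>i. P i \<omega>)) (power_intensity \<theta> \<alpha>)"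
    and "AE \<omega> in \<Omega>. decseq (\<lambda>i. P i \<omega>)"
    and "\<And>i. distributed \<Omega> lborel (Z i) (normal_density 0 (sqrt \<sigma>2))"
    and "prob_space.indep_vars \<Omega> (\<lambda>_. borel) Z UNIV"
    and "prob_space.indep_var \<Omega>
           (PiM UNIV (\<lambda>_. borel)) (\<lambda>\<omega> i. P i \<omega>)
           (PiM UNIV (\<lambda>_. borel)) (\<lambda>\<omega> i. Z i \<omega>)"
    and "prob_space M"
    and "V1 \<in> borel_measurable M" "V2 \<in> borel_measurable M"
    and "distr M (borel \<Otimes>\<^sub>M borel) (\<lambda>\<omega>. (V1 \<omega>, V2 \<omega>)) =
         distr \<Omega> (borel \<Otimes>\<^sub>M borel)
           (\<lambda>\<omega>. (1 / (1 - \<mu>\<^sup>2) * (\<Sum>i. (P i \<omega>)\<^sup>2),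
                  1 / (1 - \<mu> ^ 3) powr (1/2) * (\<Sum>i. P i \<omega> powr (3/2) * Z i \<omega>)))"
  shows "\<not> prob_space.indep_var M borel V1 borel V2"

proof
  assume indep: "prob_space.indep_var M borel V1 borel V2"
  note P = assms(8) and ppp = assms(9)
  interpret \<Omega>: prob_space \<Omega> by fact
  have Pm [measurable]: "P i \<in> borel_measurable \<Omega>" for i
    using P[of i] by (simp add: measurable_restrict_space2_iff)
  interpret normally_weighted_points \<Omega> P Z "sqrt \<sigma>2"
  proof unfold_locales
    show "0 < P i \<omega>" if "\<omega> \<in> space \<Omega>" for i \<omega>
      using measurable_space[OF P that, of i] by simp
  qed (use assms Pm in auto)
  have "\<mu> powr \<alpha> < 1"
    using assms(1-4) powr_less_mono2[of \<alpha> \<mu> 1] by simp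
  then have \<theta>: "0 < \<theta>" "\<theta> \<le> 1" using assms(6) by auto
  let ?A = "\<lambda>\<omega>. \<Sum>i. (P i \<omega>)\<^sup>2" and ?S = "\<lambda>\<omega>. \<Sum>i. P i \<omega> powr (3/2) * Z i \<omega>"
  define c d where "c = 1 / (1 - \<mu>\<^sup>2)" and "d = 1 / (1 - \<mu> ^ 3) powr (1/2)"
  have "\<mu>\<^sup>2 < 1" "\<mu> ^ 3 < 1" using assms(3,4) by (auto intro!: power_less_one_iff[THEN iffD2])
  then have cd: "c \<noteq> 0" "d \<noteq> 0" by (auto simp: c_def d_def)
  have "\<Omega>.indep_var borel (\<lambda>\<omega>. c * ?A \<omega>) borel (\<lambda>\<omega>. d * ?S \<omega>)"
    using assms(14-17) indep
    by (intro indep_var_cong_joint_law[OF assms(14,7), of V1 borel V2 borel]) (auto simp: c_def d_def)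
  then have "\<Omega>.indep_var borel ((\<lambda>x. x / c) \<circ> (\<lambda>\<omega>. c * ?A \<omega>)) borel ((\<lambda>x. x / d) \<circ> (\<lambda>\<omega>. d * ?S \<omega>))"
    by (rule \<Omega>.indep_var_compose) auto
  then have "\<Omega>.indep_var borel ?A borel ?S"
    using cd by (simp add: comp_def)
  moreover have "\<not> \<Omega>.indep_var borel ?A borel ?S"
    by (rule not_indep_sums[OF AE_summable_points_squared[OF assms(1,2) \<theta>(1) P ppp] assms(10)
      largest_point_third_moment_infinite[OF assms(1,2) \<theta> P ppp assms(10)]])
  ultimately show False by blast
qed

end
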